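(* Let $\mathcal K$ be a finite set of $\mathcal A$-invariant subalgebras $\mathfrak k$ of $\mathfrak g$ with $\mathfrak h\subsetneq\mathfrak k\subseteq\mathfrak g$, containing $\mathfrak g$, which is an upper semilattice (for any $\mathfrak k,\mathfrak l\in\mathcal K$ the smallest subalgebra of $\mathfrak g$ containing $\mathfrak k$ and $\mathfrak l$ belongs to $\mathcal K$). Put $\mathcal K^\#=\mathcal K\setminus\{\mathfrak g\}$. Then the polyhedron $/\mathcal K^\#/$ is a strong deformation retract of the compact space $D[\mathcal K]:=\bigcup_{\mathfrak k\in\mathcal K^\#}D[\mathfrak k]$.
   Context: $\mathfrak g$ is the Lie algebra of a compact Lie group with Euclidean inner product $Q$ satisfying $Q([X,Y],Z)=Q(X,[Y,Z])$; linear operators are symmetric if $Q(AX,Y)=Q(X,AY)$. $\mathfrak h\subsetneq\mathfrak g$ is a fixed subalgebra and $\mathcal A$ a compact group of automorphisms of $\mathfrak g$ preserving $\mathfrak h$ and $Q$. For an $\mathcal A$-invariant subalgebra $\mathfrak k\supseteq\mathfrak h$, $\mathfrak k\ne\mathfrak g$: $\bar\chi^{\mathfrak k}=\frac{1}{\dim(\mathfrak g/\mathfrak k)}(1_{\mathfrak g}-1_{\mathfrak k})$ ($1_{\mathfrak k}$ the $Q$-orthogonal projection onto $\mathfrak k$); $D[\mathfrak k]$ is the set of symmetric operators with nonnegative spectrum and trace $1$ commuting with all elements of $\mathcal A$, annihilating $\mathfrak k$ and commuting with $\mathrm{ad}(X)$ for all $X\in\mathfrak k$. For a chain $\varphi=(\mathfrak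 f_1\supsetneq\dots\supsetneq\mathfrak f_r)$ of members of $\mathcal K^\#$, $/\varphi/$ is the convex hull of $\{\bar\chi^{\mathfrak f_1},\dots,\bar\chi^{\mathfrak f_r}\}$, and $/\mathcal K^\#/$ is the union of $/\varphi/$ over all such chains ($r\ge1$). *)

theory Defs
  imports "HOL-Analysis.Analysis"
begin

text \<open>The Lie algebra g is modelled as a finite-dimensional real inner product space
  (type 'a::euclidean_space), whose inner product plays the role of Q, equipped with a
  bracket br.  Compact Lie algebra = Lie algebra with an ad-invariant Euclidean inner product.\<close>

definition lie_algebra :: "('a::euclidean_space \<Rightarrow> 'a \<Rightarrow> 'a) \<Rightarrow> bool" where
  "lie_algebra br \<longleftrightarrow> bilinear br \<and> (\<forall>x. br x x = 0) \<and>
     (\<forall>x y z. br x (br y z) + br y (br z x) + br z (br x y) = 0)"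

definition ad_invariant_inner :: "('a::euclidean_space \<Rightarrow> 'a \<Rightarrow> 'a) \<Rightarrow> bool" where
  "ad_invariant_inner br \<longleftrightarrow> (\<forall>x y z. inner (br x y) z = inner x (br y z))"

definition subalgebra :: "('a::euclidean_space \<Rightarrow> 'a \<Rightarrow> 'a) \<Rightarrow> 'a set \<Rightarrow> bool" where
  "subalgebra br k \<longleftrightarrow> subspace k \<and> (\<forall>x\<in>k. \<forall>y\<in>k. br x y \<in> k)"

definition subalgebra_hull :: "('a::euclidean_space \<Rightarrow> 'a \<Rightarrow> 'a) \<Rightarrow> 'a set \<Rightarrow> 'a set" where
  "subalgebra_hull br S = \<Inter>{k. subalgebra br k \<and> S \<subseteq> k}"

definition lie_automorphism :: "('a::euclidean_space \<Rightarrow> 'a \<Rightarrow> 'a) \<Rightarrow> ('a \<Rightarrow>\<^sub>L 'a) \<Rightarrow> bool" where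
  "lie_automorphism br f \<longleftrightarrow> bij (blinfun_apply f) \<and>
     (\<forall>x y. f (br x y) = br (f x) (f y))"

definition compact_aut_group ::
  "('a::euclidean_space \<Rightarrow> 'a \<Rightarrow> 'a) \<Rightarrow> 'a set \<Rightarrow> ('a \<Rightarrow>\<^sub>L 'a) set \<Rightarrow> bool" where
  "compact_aut_group br h G \<longleftrightarrow> compact G \<and> id_blinfun \<in> G \<and>
     (\<forall>f\<in>G. \<forall>g\<in>G. f o\<^sub>L g \<in> G) \<and>
     (\<forall>f\<in>G. \<exists>g\<in>G. g o\<^sub>L f = id_blinfun \<and> f o\<^sub>L g = id_blinfun) \<and>
     (\<forall>f\<in>G. lie_automorphism br f \<and> blinfun_apply f ` h = h \<and>
             (\<forall>x y. inner (f x) (f y) = inner x y))"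

definition invariant_under :: "('a::euclidean_space \<Rightarrow>\<^sub>L 'a) set \<Rightarrow> 'a set \<Rightarrow> bool" where
  "invariant_under G k \<longleftrightarrow> (\<forall>f\<in>G. blinfun_apply f ` k \<subseteq> k)"

definition symmetric_op :: "('a::euclidean_space \<Rightarrow>\<^sub>L 'a) \<Rightarrow> bool" where
  "symmetric_op A \<longleftrightarrow> (\<forall>x y. inner (A x) y = inner x (A y))"

definition op_spectrum :: "('a::euclidean_space \<Rightarrow>\<^sub>L 'a) \<Rightarrow> real set" where
  "op_spectrum A = {c. \<exists>x. x \<noteq> 0 \<and> A x = c *\<^sub>R x}"

definition op_trace :: "('a::euclidean_space \<Rightarrow>\<^sub>L 'a) \<Rightarrow> real" where
  "op_trace A = (\<Sum>b\<in>Basis. inner (A b) b)"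

definition Dset ::
  "('a::euclidean_space \<Rightarrow> 'a \<Rightarrow> 'a) \<Rightarrow> ('a \<Rightarrow>\<^sub>L 'a) set \<Rightarrow> 'a set \<Rightarrow> ('a \<Rightarrow>\<^sub>L 'a) set" where
  "Dset br G k = {A. symmetric_op A \<and> (\<forall>c\<in>op_spectrum A. c \<ge> 0) \<and> op_trace A = 1 \<and>
      (\<forall>f\<in>G. A o\<^sub>L f = f o\<^sub>L A) \<and> (\<forall>x\<in>k. A x = 0) \<and>
      (\<forall>X\<in>k. \<forall>y. A (br X y) = br X (A y))}"

definition orth_proj :: "'a::euclidean_space set \<Rightarrow> 'a \<Rightarrow> 'a" where
  "orth_proj k x = (THE y. y \<in> k \<and> (\<forall>z\<in>k. inner (x - y) z = 0))"

definition chibar :: "'a::euclidean_space set \<Rightarrow> ('a \<Rightarrow>\<^sub>L 'a)" where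
  "chibar k = Blinfun (\<lambda>x. (1 / real (DIM('a) - dim k)) *\<^sub>R (x - orth_proj k x))"

definition polyhedron :: "'a::euclidean_space set set \<Rightarrow> ('a \<Rightarrow>\<^sub>L 'a) set" where
  "polyhedron Ks = \<Union>{convex hull (chibar ` C) | C. C \<subseteq> Ks \<and> C \<noteq> {} \<and>
      (\<forall>k\<in>C. \<forall>l\<in>C. k \<subseteq> l \<or> l \<subseteq> k)}"

definition strong_deformation_retract_of ::
  "'b::topological_space set \<Rightarrow> 'b set \<Rightarrow> bool" where
  "strong_deformation_retract_of Y X \<longleftrightarrow> Y \<subseteq> X \<and>
     (\<exists>H. continuous_on ({0..1::real} \<times> X) H \<and> H ` ({0..1} \<times> X) \<subseteq> X \<and>
        (\<forall>x\<in>X. H (0, x) = x \<and> H (1, x) \<in> Y) \<and>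
        (\<forall>t\<in>{0..1}. \<forall>y\<in>Y. H (t, y) = y))"

end

theory Submission
  imports Defs
begin

text \<open>
  Every operator \<open>A\<close> in \<open>D[K]\<close> lies in \<open>D[k]\<close> for a largest \<open>k\<close>, since \<open>D[k] \<inter> D[l] = D[k \<or> l]\<close>.
  As the sets \<open>D[k]\<close> are convex, it suffices to find a retraction \<open>r\<close> of \<open>D[K]\<close> onto the polyhedron
  that maps each \<open>D[k]\<close> into itself: the straight-line homotopy from the identity to \<open>r\<close> then stays
  in \<open>D[K]\<close> and fixes the polyhedron.

  A point \<open>\<Sum> a\<^sub>g \<chi>\<^sub>g\<close> of the polyhedron determines its coefficients, because the kernel of such an
  operator is the least \<open>g\<close> with \<open>a\<^sub>g > 0\<close>. For each \<open>f\<close>, Tietze's theorem extends the function with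
  value \<open>\<Sum>\<^bsub>g \<ge> f\<^esub> a\<^sub>g\<close> on the polyhedron and value \<open>1\<close> on \<open>D[f]\<close> to a continuous function \<open>u\<^sub>f \<le> 1\<close>
  that equals \<open>1\<close> only on \<open>D[f]\<close>. Let \<open>w\<^sub>p\<close> be the maximum, over all sets \<open>S\<close> whose join is above \<open>p\<close>,
  of the minimum of \<open>u\<^sub>f\<close> over \<open>f \<in> S\<close>, and let \<open>c\<^sub>p\<close> be the difference of \<open>w\<^sub>p\<close> and the maximum of
  \<open>w\<^sub>q\<close> over \<open>q > p\<close>. At every point the \<open>p\<close> with \<open>c\<^sub>p > 0\<close> form a nonempty chain, which
  lies above \<open>k\<close> if the point is in \<open>D[k]\<close>, and on the polyhedron \<open>c = a\<close>. So \<open>r\<close> may be taken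
  to be \<open>\<Sum> c\<^sub>p \<chi>\<^sub>p\<close> divided by \<open>\<Sum> c\<^sub>p\<close>.
\<close>

section \<open>Finite semilattices of convex sets\<close>

lemma continuous_on_Max_image:
  fixes f :: "'i \<Rightarrow> 'a::topological_space \<Rightarrow> real"
  assumes "finite I" "I \<noteq> {}" "\<And>i. i \<in> I \<Longrightarrow> continuous_on S (f i)"
  shows "continuous_on S (\<lambda>x. Max ((\<lambda>i. f i x) ` I))"
  using assms
proof (induction I rule: finite_ne_induct)
  case (insert i I)
  have "(\<lambda>x. Max ((\<lambda>i. f i x) ` insert i I)) = (\<lambda>x. max (f i x) (Max ((\<lambda>i. f i x) ` I)))"
    using insert by simp
  then show ?case
    using insert by (auto intro!: continuous_on_max)
qed auto

lemma continuous_on_Min_image: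
  fixes f :: "'i \<Rightarrow> 'a::topological_space \<Rightarrow> real"
  assumes "finite I" "I \<noteq> {}" "\<And>i. i \<in> I \<Longrightarrow> continuous_on S (f i)"
  shows "continuous_on S (\<lambda>x. Min ((\<lambda>i. f i x) ` I))"
  using assms
proof (induction I rule: finite_ne_induct)
  case (insert i I)
  have "(\<lambda>x. Min ((\<lambda>i. f i x) ` insert i I)) = (\<lambda>x. min (f i x) (Min ((\<lambda>i. f i x) ` I)))"
    using insert by simp
  then show ?case
    using insert by (auto intro!: continuous_on_min)
qed auto

text \<open>The first projection maps the compact graph continuously and bijectively onto
  \<open>S\<close>, so its inverse is continuous; \<open>f\<close> is the second coordinate of that
  inverse.\<close>

lemma continuous_on_compact_graph:
  fixes f :: "'a::t2_space \<Rightarrow> 'b::t2_space"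
  assumes "compact ((\<lambda>x. (x, f x)) ` S)"
  shows "continuous_on S f"
proof -
  have "continuous_on (fst ` (\<lambda>x. (x, f x)) ` S) (\<lambda>x. (x, f x))"
    by (rule continuous_on_inv[OF _ assms]) (auto intro: continuous_intros)
  then have "continuous_on S (\<lambda>x. snd (x, f x))"
    by (intro continuous_on_snd) (simp add: image_image)
  then show ?thesis by simp
qed

lemma finite_chain_has_least:
  fixes S :: "'i::order set"
  assumes "finite S" "S \<noteq> {}" "\<And>x y. x \<in> S \<Longrightarrow> y \<in> S \<Longrightarrow> x \<le> y \<or> y \<le> x"
  obtains m where "m \<in> S" "\<And>x. x \<in> S \<Longrightarrow> m \<le> x"
  using finite_has_minimal[OF assms(1,2)] assms(3) by metis

text \<open>Emptiness of \<open>D T\<close> says that sets \<open>D k\<close> and \<open>D l\<close>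
  are disjoint when \<open>k\<close> and \<open>l\<close> have join \<open>T\<close>.
  \<open>facet\<close> abstracts the fact that a nonnegative combination of the \<open>chi g\<close>
  annihilates only vectors lying in every \<open>g\<close> with positive coefficient.\<close>

locale convex_join_system =
  fixes K :: "'i::order set" and T :: 'i
    and D :: "'i \<Rightarrow> 'v::real_normed_vector set" and chi :: "'i \<Rightarrow> 'v"
  assumes finite_K: "finite K"
    and T_in: "T \<in> K" and le_T: "\<And>k. k \<in> K \<Longrightarrow> k \<le> T"
    and D_T: "D T = {}"
    and D_compact: "\<And>k. k \<in> K \<Longrightarrow> compact (D k)"
    and D_convex: "\<And>k. k \<in> K \<Longrightarrow> convex (D k)"
    and D_antimono: "\<And>k l. k \<in> K \<Longrightarrow> l \<in> K \<Longrightarrow> k \<le> l \<Longrightarrow> D l \<subseteq> D k"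
    and join: "\<And>k l. k \<in> K \<Longrightarrow> l \<in> K \<Longrightarrow>
      \<exists>z\<in>K. k \<le> z \<and> l \<le> z \<and> (\<forall>y\<in>K. k \<le> y \<longrightarrow> l \<le> y \<longrightarrow> z \<le> y) \<and> D k \<inter> D l \<subseteq> D z"
    and chi_in: "\<And>k. k \<in> K \<Longrightarrow> k \<noteq> T \<Longrightarrow> chi k \<in> D k"
    and facet: "\<And>a k g. \<lbrakk>k \<in> K; \<And>g. (0::real) \<le> a g; (\<Sum>g\<in>K - {T}. a g *\<^sub>R chi g) \<in> D k;
      g \<in> K - {T}; 0 < a g\<rbrakk> \<Longrightarrow> k \<le> g"
begin

section \<open>Barycentric coordinates on the polyhedron\<close>

abbreviation P :: "'i set" where "P \<equiv> K - {T}"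

definition X :: "'v set" where "X = (\<Union>k\<in>P. D k)"

definition chains :: "'i set set" where
  "chains = {C. C \<subseteq> P \<and> C \<noteq> {} \<and> (\<forall>k\<in>C. \<forall>l\<in>C. k \<le> l \<or> l \<le> k)}"

definition bary :: "('i \<Rightarrow> real) set" where
  "bary = {a. (\<forall>g. 0 \<le> a g) \<and> sum a P = 1 \<and>
     (\<forall>g\<in>P. \<forall>h\<in>P. 0 < a g \<longrightarrow> 0 < a h \<longrightarrow> g \<le> h \<or> h \<le> g)}"

definition pt :: "('i \<Rightarrow> real) \<Rightarrow> 'v" where
  "pt a = (\<Sum>g\<in>P. a g *\<^sub>R chi g)"

text \<open>Written in the shape of \<open>pt\<close>, so that \<open>(pt a, tail a f)\<close> is a
  single combination of vectors in a product space.\<close>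

definition tail :: "('i \<Rightarrow> real) \<Rightarrow> 'i \<Rightarrow> real" where
  "tail a f = (\<Sum>g\<in>P. a g *\<^sub>R (if f \<le> g then 1 else 0))"

lemma finite_P: "finite P"
  using finite_K by simp

lemma finite_chains: "finite chains"
  by (rule finite_subset[of _ "Pow P"]) (auto simp: chains_def finite_K)

text \<open>The map \<open>h\<close> is general because there are two uses: \<open>chi\<close> gives
  the polyhedron, and \<open>chi\<close> paired with an indicator gives the graph of a tail
  function.\<close>

lemma Union_hull_chains:
  fixes h :: "'i \<Rightarrow> 'w::real_vector"
  shows "(\<Union>C\<in>chains. convex hull (h ` C)) = (\<lambda>a. \<Sum>g\<in>P. a g *\<^sub>R h g) ` bary"
proof (intro equalityI subsetI)
  fix x assume "x \<in> (\<Union>C\<in>chains. convex hull (h ` C))"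
  then obtain C where C: "C \<in> chains" and x: "x \<in> convex hull (h ` C)" by blast
  have CP: "C \<subseteq> P" and finC: "finite C"
    using C finite_P finite_subset by (auto simp: chains_def)
  define B where "B = {a::'i \<Rightarrow> real. (\<forall>g. 0 \<le> a g) \<and> (\<forall>g. g \<notin> C \<longrightarrow> a g = 0) \<and> sum a P = 1}"
  have "convex hull (h ` C) \<subseteq> (\<lambda>a. \<Sum>g\<in>P. a g *\<^sub>R h g) ` B"
  proof (rule hull_minimal)
    show "h ` C \<subseteq> (\<lambda>a. \<Sum>g\<in>P. a g *\<^sub>R h g) ` B"
    proof
      fix y assume "y \<in> h ` C"
      then obtain c where c: "c \<in> C" "y = h c" by blast
      let ?a = "\<lambda>g. if g = c then 1 else (0::real)"
      have "?a \<in> B" using c CP finite_P by (auto simp: B_def)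
      moreover have "(\<Sum>g\<in>P. ?a g *\<^sub>R h g) = (\<Sum>g\<in>P. if g = c then h g else 0)"
        by (rule sum.cong) auto
      then have "(\<Sum>g\<in>P. ?a g *\<^sub>R h g) = y"
        using c CP finite_P by auto
      ultimately show "y \<in> (\<lambda>a. \<Sum>g\<in>P. a g *\<^sub>R h g) ` B"
        by (intro image_eqI[of _ _ ?a]) simp_all
    qed
    show "convex ((\<lambda>a. \<Sum>g\<in>P. a g *\<^sub>R h g) ` B)"
    proof (rule convexI)
      fix y z and s t :: real
      assume y: "y \<in> (\<lambda>a. \<Sum>g\<in>P. a g *\<^sub>R h g) ` B" and z: "z \<in> (\<lambda>a. \<Sum>g\<in>P. a g *\<^sub>R h g) ` B"
        and st: "0 \<le> s" "0 \<le> t" "s + t = 1"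
      then obtain a b where ab: "a \<in> B" "b \<in> B"
        and "y = (\<Sum>g\<in>P. a g *\<^sub>R h g)" "z = (\<Sum>g\<in>P. b g *\<^sub>R h g)" by blast
      then have "s *\<^sub>R y + t *\<^sub>R z = (\<Sum>g\<in>P. (s * a g + t * b g) *\<^sub>R h g)"
        by (simp add: scaleR_sum_right sum.distrib scaleR_add_left)
      moreover have "(\<lambda>g. s * a g + t * b g) \<in> B"
        using ab st by (auto simp: B_def sum.distrib simp flip: sum_distrib_left)
      ultimately show "s *\<^sub>R y + t *\<^sub>R z \<in> (\<lambda>a. \<Sum>g\<in>P. a g *\<^sub>R h g) ` B"
        by (rule image_eqI)
    qed
  qed
  moreover have "B \<subseteq> bary"
    using C unfolding B_def bary_def chains_def by (auto simp: less_le) metis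
  ultimately show "x \<in> (\<lambda>a. \<Sum>g\<in>P. a g *\<^sub>R h g) ` bary"
    using x by blast
next
  fix x assume "x \<in> (\<lambda>a. \<Sum>g\<in>P. a g *\<^sub>R h g) ` bary"
  then obtain a where a: "a \<in> bary" and x: "x = (\<Sum>g\<in>P. a g *\<^sub>R h g)" by blast
  define C where "C = {g\<in>P. 0 < a g}"
  have a0: "\<And>g. 0 \<le> a g" and a1: "sum a P = 1" using a by (auto simp: bary_def)
  have CP: "C \<subseteq> P" "finite C" using finite_P by (auto simp: C_def)
  have z: "a g = 0" if "g \<in> P - C" for g using that a0[of g] by (auto simp: C_def)
  have s1: "sum a C = 1"
    using a1 sum.mono_neutral_left[OF finite_P CP(1), of a] z by auto
  then have "C \<noteq> {}" by auto
  then have "C \<in> chains"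
    using a CP by (auto simp: chains_def bary_def C_def)
  moreover have "x = (\<Sum>g\<in>C. a g *\<^sub>R h g)"
    unfolding x by (rule sum.mono_neutral_right[OF finite_P CP(1)]) (simp add: z)
  then have "x \<in> convex hull (h ` C)"
    using CP s1 a0 by (simp, intro convex_sum) (auto intro: hull_inc)
  ultimately show "x \<in> (\<Union>C\<in>chains. convex hull (h ` C))" by blast
qed

lemma pt_in_D:
  assumes a: "a \<in> bary" and k: "k \<in> K" and le: "\<And>g. g \<in> P \<Longrightarrow> 0 < a g \<Longrightarrow> k \<le> g"
  shows "pt a \<in> D k"
proof -
  define C where "C = {g\<in>P. 0 < a g}"
  have a0: "\<And>g. 0 \<le> a g" and a1: "sum a P = 1" using a by (auto simp: bary_def)
  have CP: "C \<subseteq> P" "finite C" using finite_P by (auto simp: C_def)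
  have z: "a g = 0" if "g \<in> P - C" for g using that a0[of g] by (auto simp: C_def)
  have s1: "sum a C = 1"
    using a1 sum.mono_neutral_left[OF finite_P CP(1), of a] z by auto
  have "pt a = (\<Sum>g\<in>C. a g *\<^sub>R chi g)"
    unfolding pt_def by (rule sum.mono_neutral_right[OF finite_P CP(1)]) (simp add: z)
  moreover have "chi g \<in> D k" if "g \<in> C" for g
    using that le k chi_in D_antimono[OF k, of g] by (auto simp: C_def)
  ultimately show ?thesis
    using CP s1 a0 D_convex[OF k] by (auto intro!: convex_sum)
qed

lemma pt_in_D_iff:
  assumes a: "a \<in> bary" and k: "k \<in> K"
  shows "pt a \<in> D k \<longleftrightarrow> (\<forall>g\<in>P. 0 < a g \<longrightarrow> k \<le> g)"
  using pt_in_D[OF a k] facet[OF k, of a] a unfolding pt_def bary_def by blast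

lemma bary_support_least:
  assumes "a \<in> bary"
  obtains p where "p \<in> P" "0 < a p" "\<And>g. g \<in> P \<Longrightarrow> 0 < a g \<Longrightarrow> p \<le> g"
proof -
  have a0: "\<And>g. 0 \<le> a g" and a1: "sum a P = 1" using assms by (auto simp: bary_def)
  have "\<exists>g\<in>P. a g \<noteq> 0"
    using a1 by (metis sum.neutral zero_neq_one)
  then have "{g\<in>P. 0 < a g} \<noteq> {}" using a0 by (auto simp: less_le)
  then obtain p where "p \<in> {g\<in>P. 0 < a g}" "\<And>x. x \<in> {g\<in>P. 0 < a g} \<Longrightarrow> p \<le> x"
    using finite_chain_has_least[of "{g\<in>P. 0 < a g}"] finite_P assms by (auto simp: bary_def)
  then show ?thesis using that by blast
qed

lemma pt_in_X: "a \<in> bary \<Longrightarrow> pt a \<in> X"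
  using bary_support_least[of a] pt_in_D[of a] unfolding X_def by blast

text \<open>Cancelling the common part of two representations of the same point leaves two
  representations with disjoint supports, but the facet condition forces their supports
  to have the same least element.\<close>

lemma pt_inj:
  assumes a: "a \<in> bary" and b: "b \<in> bary" and eq: "pt a = pt b" and g: "g \<in> P"
  shows "a g = b g"
proof -
  define m where "m g = min (a g) (b g)" for g
  define s where "s = 1 - sum m P"
  have a0: "0 \<le> a g" and b0: "0 \<le> b g" for g using a b by (auto simp: bary_def)
  have sa: "(\<Sum>g\<in>P. a g - m g) = s" and sb: "(\<Sum>g\<in>P. b g - m g) = s"
    using a b by (auto simp: s_def sum_subtractf bary_def)
  have am: "0 \<le> a g - m g" and bm: "0 \<le> b g - m g" for g by (auto simp: m_def)
  have s0: "0 \<le> s" using sum_nonneg[of P "\<lambda>g. a g - m g"] am sa by auto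
  have "s = 0"
  proof (rule ccontr)
    assume "s \<noteq> 0"
    with s0 have s: "0 < s" by simp
    define a' where "a' g = (a g - m g) / s" for g
    define b' where "b' g = (b g - m g) / s" for g
    have pos: "0 < a' g \<longleftrightarrow> b g < a g" "0 < b' g \<longleftrightarrow> a g < b g" for g
      using s by (auto simp: a'_def b'_def m_def zero_less_divide_iff)
    have a': "a' \<in> bary"
      unfolding bary_def
    proof (intro CollectI conjI ballI impI allI)
      show "0 \<le> a' g" for g using am[of g] s by (simp add: a'_def)
      show "sum a' P = 1" using sa s by (simp add: a'_def flip: sum_divide_distrib)
      fix g h assume "g \<in> P" "h \<in> P" "0 < a' g" "0 < a' h"
      then have "0 < a g" "0 < a h" using pos b0[of g] b0[of h] by auto
      then show "g \<le> h \<or> h \<le> g" using a \<open>g \<in> P\<close> \<open>h \<in> P\<close> by (auto simp: bary_def)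
    qed
    have b': "b' \<in> bary"
      unfolding bary_def
    proof (intro CollectI conjI ballI impI allI)
      show "0 \<le> b' g" for g using bm[of g] s by (simp add: b'_def)
      show "sum b' P = 1" using sb s by (simp add: b'_def flip: sum_divide_distrib)
      fix g h assume "g \<in> P" "h \<in> P" "0 < b' g" "0 < b' h"
      then have "0 < b g" "0 < b h" using pos a0[of g] a0[of h] by auto
      then show "g \<le> h \<or> h \<le> g" using b \<open>g \<in> P\<close> \<open>h \<in> P\<close> by (auto simp: bary_def)
    qed
    have "pt a' = (1 / s) *\<^sub>R (pt a - pt m)"
      by (simp add: pt_def a'_def scaleR_sum_right sum_subtractf scaleR_diff_left
          scaleR_diff_right diff_divide_distrib)
    moreover have "pt b' = (1 / s) *\<^sub>R (pt b - pt m)"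
      by (simp add: pt_def b'_def scaleR_sum_right sum_subtractf scaleR_diff_left
          scaleR_diff_right diff_divide_distrib)
    ultimately have eq': "pt a' = pt b'" using eq by simp
    obtain p where p: "p \<in> P" "0 < a' p" "\<And>g. g \<in> P \<Longrightarrow> 0 < a' g \<Longrightarrow> p \<le> g"
      using bary_support_least[OF a'] by blast
    obtain q where q: "q \<in> P" "0 < b' q" "\<And>g. g \<in> P \<Longrightarrow> 0 < b' g \<Longrightarrow> q \<le> g"
      using bary_support_least[OF b'] by blast
    have "p \<le> q"
      using pt_in_D_iff[OF b', of p] pt_in_D[OF a', of p] p q eq' by auto
    moreover have "q \<le> p"
      using pt_in_D_iff[OF a', of q] pt_in_D[OF b', of q] p q eq' by auto
    ultimately have "p = q" by simp
    then show False using pos[of p] p q by auto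
  qed
  then have "\<forall>g\<in>P. a g - m g = 0" "\<forall>g\<in>P. b g - m g = 0"
    using sum_nonneg_eq_0_iff[OF finite_P, of "\<lambda>g. a g - m g"]
      sum_nonneg_eq_0_iff[OF finite_P, of "\<lambda>g. b g - m g"] am bm sa sb by auto
  then show ?thesis using g by auto
qed

section \<open>Tail sums and their continuous extension\<close>

lemma tail_bounds:
  assumes a: "a \<in> bary"
  shows "0 \<le> tail a f" "tail a f \<le> 1"
proof -
  have a0: "\<And>g. 0 \<le> a g" and a1: "sum a P = 1" using a by (auto simp: bary_def)
  show "0 \<le> tail a f" unfolding tail_def by (rule sum_nonneg) (simp add: a0)
  have "tail a f \<le> sum a P" unfolding tail_def by (rule sum_mono) (simp add: a0)
  then show "tail a f \<le> 1" using a1 by simp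
qed

text \<open>\<open>1 - tail a f\<close> is the mass on those \<open>g\<close> that are not above
  \<open>f\<close>; it vanishes exactly when the whole support lies above \<open>f\<close>.\<close>

lemma tail_eq_1_iff:
  assumes a: "a \<in> bary" and f: "f \<in> K"
  shows "tail a f = 1 \<longleftrightarrow> pt a \<in> D f"
proof -
  have a0: "\<And>g. 0 \<le> a g" and a1: "sum a P = 1" using a by (auto simp: bary_def)
  have "1 - tail a f = (\<Sum>g\<in>P. if f \<le> g then 0 else a g)"
  proof -
    have "sum a P - tail a f = (\<Sum>g\<in>P. if f \<le> g then 0 else a g)"
      unfolding tail_def sum_subtractf[symmetric] by (rule sum.cong) auto
    then show ?thesis using a1 by simp
  qed
  moreover have "(\<Sum>g\<in>P. if f \<le> g then 0 else a g) = 0 \<longleftrightarrow> (\<forall>g\<in>P. (if f \<le> g then 0 else a g) = 0)"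
    using a0 by (intro sum_nonneg_eq_0_iff finite_P) auto
  moreover have "\<dots> \<longleftrightarrow> (\<forall>g\<in>P. 0 < a g \<longrightarrow> f \<le> g)"
    using a0 by (auto simp: less_le) 
  ultimately show ?thesis using pt_in_D_iff[OF a f] by auto
qed

text \<open>The prescribed values are continuous because their graph is compact: over the polyhedron
  it is a finite union of convex hulls of finite sets. Dividing the Tietze extension by
  \<open>1 + infdist x S\<close> makes it smaller than \<open>1\<close> outside the set \<open>S\<close> of prescription.\<close>

lemma tail_extension:
  assumes f: "f \<in> K"
  obtains u :: "'v \<Rightarrow> real" where "continuous_on UNIV u" "\<And>x. u x \<le> 1"
    "\<And>a. a \<in> bary \<Longrightarrow> u (pt a) = tail a f" "\<And>x. x \<in> X \<Longrightarrow> u x = 1 \<longleftrightarrow> x \<in> D f"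
proof -
  define Gr where "Gr = (\<lambda>a. (pt a, tail a f)) ` bary \<union> D f \<times> {1}"
  have "(\<lambda>a. (pt a, tail a f)) =
      (\<lambda>a. \<Sum>g\<in>P. a g *\<^sub>R (chi g, if f \<le> g then 1 else (0::real)))"
    by (rule ext) (simp add: pt_def tail_def sum_prod)
  then have "(\<lambda>a. (pt a, tail a f)) ` bary =
      (\<Union>C\<in>chains. convex hull ((\<lambda>g. (chi g, if f \<le> g then 1 else (0::real))) ` C))"
    by (simp only: Union_hull_chains)
  moreover have "compact \<dots>"
    by (intro compact_UN finite_chains finite_imp_compact_convex_hull finite_imageI)
      (auto simp: chains_def finite_P intro: finite_subset[OF _ finite_P])
  ultimately have cGr: "compact Gr"
    unfolding Gr_def using D_compact[OF f] by (auto intro!: compact_Un compact_Times)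
  \<comment> \<open>On the polyhedron \<open>pt_inj\<close> makes the tail a function of the point,
    and where the polyhedron meets \<open>D f\<close> this tail is \<open>1\<close>, in agreement
    with the other prescription.\<close>
  have single: "s = t" if "(x, s) \<in> Gr" "(x, t) \<in> Gr" for x s t
  proof -
    have eq: "tail a f = tail b f" if "a \<in> bary" "b \<in> bary" "pt a = pt b" for a b
      unfolding tail_def by (rule sum.cong) (use pt_inj[OF that] in auto)
    have 1: "tail a f = 1" if "a \<in> bary" "pt a \<in> D f" for a
      using tail_eq_1_iff[OF _ f] that by blast
    have cases: "(\<exists>a\<in>bary. x = pt a \<and> r = tail a f) \<or> x \<in> D f \<and> r = 1" if "(x, r) \<in> Gr" for r
      using that unfolding Gr_def by blast
    show ?thesis using cases[OF that(1)] cases[OF that(2)] eq 1 by metis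
  qed
  define S where "S = fst ` Gr"
  define v where "v x = (THE s. (x, s) \<in> Gr)" for x
  have v: "v x = s" if "(x, s) \<in> Gr" for x s
    unfolding v_def using that single by blast
  have graph: "(\<lambda>x. (x, v x)) ` S = Gr"
    using v by (force simp: S_def)
  have contv: "continuous_on S v"
    by (rule continuous_on_compact_graph) (simp add: graph cGr)
  have cS: "compact S"
    unfolding S_def by (rule compact_continuous_image[OF _ cGr]) (auto intro: continuous_intros)
  have "v ` S \<subseteq> {0..1}"
  proof
    fix s assume "s \<in> v ` S"
    then obtain x where "(x, s) \<in> Gr" using graph by force
    then show "s \<in> {0..1}" using tail_bounds by (auto simp: Gr_def)
  qed
  then obtain w where w: "continuous_map euclidean euclideanreal w"
      "\<And>x. x \<in> S \<Longrightarrow> w x = v x" "w ` topspace euclidean \<subseteq> {0..1}"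
    using Tietze_extension_closed_real_interval[of euclidean S v 0 1] contv cS
    by (auto simp: metrizable_imp_normal_space metrizable_space_euclidean compact_imp_closed)
  define u where "u x = w x / (1 + infdist x S)" for x
  have wb: "0 \<le> w x" "w x \<le> 1" for x using w(3) by (auto simp: image_subset_iff)
  have uS: "u x = v x" if "x \<in> S" for x using that w(2) by (simp add: u_def)
  have uGr: "u x = s" if "(x, s) \<in> Gr" for x s
    using that uS[of x] v[OF that] unfolding S_def by force
  have ule: "u x \<le> 1" for x
    using wb[of x] infdist_nonneg[of x S] by (auto simp: u_def divide_le_eq)
  show thesis
  proof
    show "continuous_on UNIV u"
    proof -
      have "1 + infdist x S \<noteq> 0" for x using infdist_nonneg[of x S] by linarith
      then show ?thesis using w(1) unfolding u_def by (intro continuous_intros) auto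
    qed
    show "u x \<le> 1" for x by (rule ule)
    show "u (pt a) = tail a f" if "a \<in> bary" for a
      using that by (intro uGr) (auto simp: Gr_def)
    show "u x = 1 \<longleftrightarrow> x \<in> D f" if x: "x \<in> X" for x
    proof
      assume "x \<in> D f" then show "u x = 1" by (intro uGr) (auto simp: Gr_def)
    next
      assume u1: "u x = 1"
      have "x \<in> S"
      proof (rule ccontr)
        assume "x \<notin> S"
        \<comment> \<open>\<open>infdist\<close> to the empty set is \<open>0\<close>, so
          \<open>S\<close> needs a point: the vertex \<open>chi k\<close>.\<close>
        obtain k where k: "k \<in> P" using x unfolding X_def by blast
        let ?a = "\<lambda>g. if g = k then 1 else (0::real)"
        have "?a \<in> bary" using k finite_P by (auto simp: bary_def)
        then have "S \<noteq> {}" by (auto simp: S_def Gr_def)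
        then have "0 < infdist x S"
          using \<open>x \<notin> S\<close> cS by (meson compact_imp_closed infdist_pos_not_in_closed)
        then have "u x < 1" using wb[of x] by (auto simp: u_def divide_less_eq)
        then show False using u1 by simp
      qed
      then have "(x, u x) \<in> Gr" using graph uS by force
      then show "x \<in> D f" using u1 tail_eq_1_iff[OF _ f] by (auto simp: Gr_def)
    qed
  qed
qed

section \<open>Closure of functions under joins, and weights supported on chains\<close>

text \<open>If joins are denoted by \<open>\<or>\<close> then \<open>cover p\<close> consists of the sets with join above \<open>p\<close>, and
  \<open>W v\<close> is the least function \<open>w \<ge> v\<close> that is antitone and satisfies
  \<open>min (w p) (w q) \<le> w (p \<or> q)\<close>. It is this inequality that forces the support of
  \<open>weight v\<close> to be a chain.\<close>

definition cover :: "'i \<Rightarrow> 'i set set" where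
  "cover p = {S. S \<subseteq> K \<and> S \<noteq> {} \<and> (\<forall>z\<in>K. (\<forall>f\<in>S. f \<le> z) \<longrightarrow> p \<le> z)}"

definition W :: "('i \<Rightarrow> real) \<Rightarrow> 'i \<Rightarrow> real" where
  "W v p = Max ((\<lambda>S. Min (v ` S)) ` cover p)"

definition weight :: "('i \<Rightarrow> real) \<Rightarrow> 'i \<Rightarrow> real" where
  "weight v p = W v p - Max (W v ` {q\<in>K. p < q})"

lemma finite_cover: "finite (cover p)"
  by (rule finite_subset[of _ "Pow K"]) (auto simp: cover_def finite_K)

lemma cover_finite: "S \<in> cover p \<Longrightarrow> finite S"
  using finite_K by (auto simp: cover_def intro: finite_subset)

lemma singleton_cover: "p \<in> K \<Longrightarrow> {p} \<in> cover p"
  by (auto simp: cover_def)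

lemma W_attained:
  assumes "p \<in> K"
  obtains S where "S \<in> cover p" "W v p = Min (v ` S)"
proof -
  have "W v p \<in> (\<lambda>S. Min (v ` S)) ` cover p"
    unfolding W_def using finite_cover singleton_cover[OF assms] by (intro Max_in) auto
  then show ?thesis using that by blast
qed

lemma Min_le_W: "S \<in> cover p \<Longrightarrow> Min (v ` S) \<le> W v p"
  unfolding W_def using finite_cover by (intro Max_ge) auto

lemma le_W: "p \<in> K \<Longrightarrow> v p \<le> W v p"
  using Min_le_W[OF singleton_cover, of p v] by simp

lemma W_antimono:
  assumes "q \<in> K" "p \<le> q"
  shows "W v q \<le> W v p"
proof -
  obtain S where S: "S \<in> cover q" "W v q = Min (v ` S)" by (rule W_attained[OF assms(1)])
  then have "S \<in> cover p" using assms(2) by (auto simp: cover_def intro: order_trans)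
  then show ?thesis using S Min_le_W by metis
qed

text \<open>The union of optimal covers of \<open>p\<close> and \<open>q\<close> is a cover of
  \<open>z\<close>: whatever bounds it lies above \<open>p\<close> and \<open>q\<close>, hence above
  \<open>z\<close>.\<close>

lemma W_join:
  assumes "p \<in> K" "q \<in> K" and z: "\<And>y. y \<in> K \<Longrightarrow> p \<le> y \<Longrightarrow> q \<le> y \<Longrightarrow> z \<le> y"
  shows "min (W v p) (W v q) \<le> W v z"
proof -
  obtain S where S: "S \<in> cover p" "W v p = Min (v ` S)" by (rule W_attained[OF assms(1)])
  obtain R where R: "R \<in> cover q" "W v q = Min (v ` R)" by (rule W_attained[OF assms(2)])
  have "S \<union> R \<in> cover z" using S R z by (auto simp: cover_def)
  then have "Min (v ` (S \<union> R)) \<le> W v z" by (rule Min_le_W)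
  moreover have "Min (v ` (S \<union> R)) = min (W v p) (W v q)"
    unfolding S(2) R(2) image_Un
    using S R cover_finite[OF S(1)] cover_finite[OF R(1)]
    by (intro Min_Un) (auto simp: cover_def)
  ultimately show ?thesis by simp
qed

lemma W_le_Max:
  assumes "q \<in> K" "p < q"
  shows "W v q \<le> Max (W v ` {q\<in>K. p < q})"
  using assms finite_K by (intro Max_ge) auto

lemma above_nonempty: "p \<in> P \<Longrightarrow> {q\<in>K. p < q} \<noteq> {}"
  using T_in le_T[of p] by (auto simp: less_le)

lemma weight_nonneg:
  assumes "p \<in> P"
  shows "0 \<le> weight v p"
proof -
  have "Max (W v ` {q\<in>K. p < q}) \<le> W v p"
    using above_nonempty[OF assms] finite_K W_antimono by (subst Max_le_iff) auto
  then show ?thesis by (simp add: weight_def)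
qed

text \<open>By \<open>W_join\<close> the join of \<open>p\<close> and \<open>q\<close> has a
  \<open>W\<close>-value at least that of \<open>p\<close>. If the join were strictly above
  \<open>p\<close>, there would be no drop at \<open>p\<close>.\<close>

lemma weight_pos_le:
  assumes p: "p \<in> P" "0 < weight v p" and q: "q \<in> K" "W v p \<le> W v q"
  shows "q \<le> p"
proof -
  obtain z where z: "z \<in> K" "p \<le> z" "q \<le> z" "\<forall>y\<in>K. p \<le> y \<longrightarrow> q \<le> y \<longrightarrow> z \<le> y"
    using join[of p q] p q by blast
  have "W v p \<le> W v z" using W_join[of p q z v] p q z by auto
  then have "\<not> p < z" using W_le_Max[OF z(1), of p v] p(2) by (auto simp: weight_def)
  then show ?thesis using z by (simp add: less_le)
qed

text \<open>The indices \<open>z\<close> with \<open>x\<close> in \<open>D z\<close> are closed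
  under joins, so a maximal one is greatest.\<close>

lemma D_greatest:
  assumes "x \<in> D k" "k \<in> K"
  obtains z where "z \<in> K" "x \<in> D z" "\<And>f. f \<in> K \<Longrightarrow> x \<in> D f \<Longrightarrow> f \<le> z"
proof -
  have "finite {z\<in>K. x \<in> D z}" "{z\<in>K. x \<in> D z} \<noteq> {}" using finite_K assms by auto
  then obtain z where z: "z \<in> K" "x \<in> D z" "\<And>y. y \<in> K \<Longrightarrow> x \<in> D y \<Longrightarrow> z \<le> y \<Longrightarrow> z = y"
    using finite_has_maximal[of "{z\<in>K. x \<in> D z}"] by blast
  have "f \<le> z" if f: "f \<in> K" "x \<in> D f" for f
  proof -
    obtain y where "y \<in> K" "f \<le> y" "z \<le> y" "x \<in> D y"
      using join[of f z] z f by blast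
    then show ?thesis using z(3) by metis
  qed
  then show ?thesis using that z by blast
qed

text \<open>If the minimum over a cover of \<open>T\<close> were \<open>1\<close>, the point would
  lie in \<open>D f\<close> for all its members. They would be bounded by the greatest index of the
  point, which would then be \<open>T\<close>, against \<open>D T = {}\<close>.\<close>

lemma W_T_less_1:
  assumes v: "\<And>f. f \<in> K \<Longrightarrow> v f \<le> 1" "\<And>f. f \<in> K \<Longrightarrow> v f = 1 \<Longrightarrow> x \<in> D f"
  shows "W v T < 1"
proof -
  obtain S where S: "S \<in> cover T" "W v T = Min (v ` S)" by (rule W_attained[OF T_in])
  have fin: "finite S" "S \<noteq> {}" "S \<subseteq> K" using S cover_finite by (auto simp: cover_def)
  have "\<exists>f\<in>S. v f < 1"
  proof (rule ccontr)
    assume "\<not> (\<exists>f\<in>S. v f < 1)"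
    then have in_D: "x \<in> D f" if "f \<in> S" for f using v that fin by (meson antisym_conv2 subsetD)
    obtain f where f: "f \<in> S" using fin by blast
    obtain z where z: "z \<in> K" "x \<in> D z" "\<And>f. f \<in> K \<Longrightarrow> x \<in> D f \<Longrightarrow> f \<le> z"
      using D_greatest[of x f] in_D f fin by blast
    then have "\<forall>f\<in>S. f \<le> z" using in_D fin by blast
    then have "T \<le> z" using S(1) z(1) by (simp add: cover_def)
    then have "z = T" using le_T z by (simp add: antisym)
    then show False using z D_T by simp
  qed
  then show ?thesis unfolding S(2) using fin by (subst Min_less_iff) auto
qed

lemma W_le_1:
  assumes p: "p \<in> K" and v: "\<And>f. f \<in> K \<Longrightarrow> v f \<le> 1"
  shows "W v p \<le> 1"
proof -
  obtain S where S: "S \<in> cover p" "W v p = Min (v ` S)" by (rule W_attained[OF p])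
  then obtain f where f: "f \<in> S" "f \<in> K" by (auto simp: cover_def)
  have "Min (v ` S) \<le> v f" using f cover_finite[OF S(1)] by auto
  then show ?thesis using S v[OF f(2)] by linarith
qed

text \<open>\<open>W v k\<close> attains the upper bound \<open>1\<close>, so
  \<open>weight_pos_le\<close> applies with \<open>q = k\<close>. This keeps the retraction inside
  each \<open>D k\<close>.\<close>

lemma weight_support:
  assumes p: "p \<in> P" "0 < weight v p" and v: "\<And>f. f \<in> K \<Longrightarrow> v f \<le> 1" and k: "k \<in> K" "v k = 1"
  shows "k \<le> p"
  using weight_pos_le[OF p k(1)] W_le_1[of p v] le_W[OF k(1), of v] p v k by force

text \<open>A maximal \<open>p\<close> with \<open>W v p = 1\<close> works: \<open>W v\<close> is
  smaller everywhere above it, and \<open>p\<close> is not \<open>T\<close>. This makes the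
  normalising sum positive.\<close>

lemma ex_weight_pos:
  assumes v: "\<And>f. f \<in> K \<Longrightarrow> v f \<le> 1" and k: "k \<in> K" "v k = 1" and T: "W v T < 1"
  obtains p where "p \<in> P" "0 < weight v p"
proof -
  let ?M = "{p\<in>K. W v p = 1}"
  have "k \<in> ?M" using W_le_1[of k v] le_W[OF k(1), of v] v k by force
  then obtain p where p: "p \<in> ?M" "\<And>y. y \<in> ?M \<Longrightarrow> p \<le> y \<Longrightarrow> p = y"
    using finite_has_maximal[of ?M] finite_K by auto
  have pP: "p \<in> P" using p T by auto
  have "W v q < 1" if "q \<in> K" "p < q" for q
    using that p(2)[of q] W_le_1[OF that(1), of v] v by (auto simp: less_le)
  then have "Max (W v ` {q\<in>K. p < q}) < 1"
    using above_nonempty[OF pP] finite_K by (subst Max_less_iff) auto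
  then show ?thesis using p pP that[of p] by (auto simp: weight_def)
qed

text \<open>As the support of \<open>a\<close> is a chain, its parts above the various
  \<open>f\<close> in a cover are nested. The smallest part lies above all members of the cover,
  hence above \<open>p\<close>, so its mass is at most \<open>tail a p\<close>.\<close>

lemma W_tail:
  assumes a: "a \<in> bary" and v: "\<And>f. f \<in> K \<Longrightarrow> v f = tail a f" and p: "p \<in> K"
  shows "W v p = tail a p"
proof (rule antisym)
  have a0: "\<And>g. 0 \<le> a g" using a by (auto simp: bary_def)
  obtain S where S: "S \<in> cover p" "W v p = Min (v ` S)" by (rule W_attained[OF p])
  have fin: "finite S" "S \<noteq> {}" "S \<subseteq> K" using S cover_finite by (auto simp: cover_def)
  define U where "U f = {g\<in>P. 0 < a g \<and> f \<le> g}" for f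
  have nested: "U f \<subseteq> U f' \<or> U f' \<subseteq> U f" for f f'
  proof (rule ccontr)
    assume "\<not> ?thesis"
    then obtain g g' where "g \<in> U f" "g \<notin> U f'" "g' \<in> U f'" "g' \<notin> U f" by blast
    moreover from this have "g \<le> g' \<or> g' \<le> g" using a by (auto simp: U_def bary_def)
    ultimately show False by (auto simp: U_def intro: order_trans)
  qed
  obtain m where m: "m \<in> U ` S" "\<And>x. x \<in> U ` S \<Longrightarrow> m \<subseteq> x"
  proof (rule finite_chain_has_least[of "U ` S"])
    show "x \<subseteq> y \<or> y \<subseteq> x" if "x \<in> U ` S" "y \<in> U ` S" for x y
      using that nested by blast
  qed (use fin in auto)
  then obtain f where f: "f \<in> S" "\<And>f'. f' \<in> S \<Longrightarrow> U f \<subseteq> U f'" by blast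
  have "U f \<subseteq> U p"
  proof
    fix g assume g: "g \<in> U f"
    then have "\<forall>f'\<in>S. f' \<le> g" using f(2) by (auto simp: U_def)
    then show "g \<in> U p" using g S(1) by (auto simp: U_def cover_def)
  qed
  then have "tail a f \<le> tail a p"
    unfolding tail_def
  proof (intro sum_mono)
    fix g assume "g \<in> P"
    then have "a g = 0 \<or> (f \<le> g \<longrightarrow> p \<le> g)"
      using \<open>U f \<subseteq> U p\<close> a0[of g] by (force simp: U_def less_le)
    then show "a g *\<^sub>R (if f \<le> g then 1 else 0) \<le> (a g *\<^sub>R (if p \<le> g then 1 else 0) :: real)"
      using a0[of g] by auto
  qed
  moreover have "Min (v ` S) \<le> tail a f" using f(1) fin v by (metis Min_le finite_imageI imageI subsetD)
  ultimately show "W v p \<le> tail a p" using S by linarith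
  show "tail a p \<le> W v p" using le_W[OF p, of v] v[OF p] by simp
qed

text \<open>Passing from \<open>p\<close> to the next support element above it removes exactly the
  mass \<open>a p\<close> from the tail, and passing to any larger index removes at least that
  much.\<close>

lemma weight_tail:
  assumes a: "a \<in> bary" and v: "\<And>f. f \<in> K \<Longrightarrow> v f = tail a f" and p: "p \<in> P"
  shows "weight v p = a p"
proof -
  have a0: "\<And>g. 0 \<le> a g" using a by (auto simp: bary_def)
  \<comment> \<open>Adding \<open>T\<close>, whose tail is \<open>0\<close>, provides a next element
    even if no support element lies above \<open>p\<close>.\<close>
  define A where "A = {g\<in>P. 0 < a g \<and> p < g} \<union> {T}"
  have AK: "A \<subseteq> K" "A \<noteq> {}" and Ap: "\<And>g. g \<in> A \<Longrightarrow> p < g"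
    using T_in p le_T[of p] by (auto simp: A_def less_le)
  have chain: "x \<le> y \<or> y \<le> x" if "x \<in> A" "y \<in> A" for x y
    using that a le_T by (auto simp: A_def bary_def)
  obtain q where q: "q \<in> A" "\<And>g. g \<in> A \<Longrightarrow> q \<le> g"
    by (rule finite_chain_has_least[of A]) (use finite_subset[OF AK(1) finite_K] AK chain in auto)
  have le: "tail a r \<le> tail a p - a p" if "p < r" for r
  proof -
    have "tail a r \<le> (\<Sum>g\<in>P. a g *\<^sub>R (if p < g then 1 else 0))"
      unfolding tail_def using a0 that by (intro sum_mono) auto
    also have "\<dots> = tail a p - (\<Sum>g\<in>P. if g = p then a g else 0)"
      unfolding tail_def sum_subtractf[symmetric] by (intro sum.cong) (auto simp: less_le)
    finally show ?thesis using p finite_P by simp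
  qed
  have "tail a p - a p = tail a p - (\<Sum>g\<in>P. if g = p then a g else 0)"
    using p finite_P by simp
  also have "\<dots> \<le> tail a q"
    unfolding tail_def sum_subtractf[symmetric]
  proof (intro sum_mono)
    fix g assume "g \<in> P"
    show "a g *\<^sub>R (if p \<le> g then 1 else 0) - (if g = p then a g else 0)
        \<le> a g *\<^sub>R (if q \<le> g then 1 else 0)"
      using q(2)[of g] \<open>g \<in> P\<close> a0[of g] by (auto simp: A_def less_le)
  qed
  finally have q_eq: "tail a q = tail a p - a p" using le[OF Ap[OF q(1)]] by simp
  have Wt: "W v r = tail a r" if "r \<in> K" for r by (rule W_tail[OF a v that])
  have "Max (W v ` {q\<in>K. p < q}) = tail a p - a p"
  proof (rule Max_eqI)
    show "finite (W v ` {q\<in>K. p < q})" using finite_K by simp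
    show "y \<le> tail a p - a p" if "y \<in> W v ` {q\<in>K. p < q}" for y using that le Wt by auto
    show "tail a p - a p \<in> W v ` {q\<in>K. p < q}"
      using q_eq Wt[of q] q(1) AK Ap by (metis (mono_tags, lifting) imageI mem_Collect_eq subsetD)
  qed
  then show ?thesis using Wt p by (simp add: weight_def)
qed

section \<open>The retraction and the straight-line homotopy\<close>

lemma continuous_on_weight:
  assumes u: "\<And>f. f \<in> K \<Longrightarrow> continuous_on X (u f)" and p: "p \<in> P"
  shows "continuous_on X (\<lambda>x. weight (\<lambda>f. u f x) p)"
proof -
  have W: "continuous_on X (\<lambda>x. W (\<lambda>f. u f x) p)" if "p \<in> K" for p
    unfolding W_def
  proof (rule continuous_on_Max_image[OF finite_cover])
    show "cover p \<noteq> {}" using singleton_cover[OF that] by blast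
    show "continuous_on X (\<lambda>x. Min ((\<lambda>f. u f x) ` S))" if "S \<in> cover p" for S
      using that cover_finite[OF that] u by (intro continuous_on_Min_image) (auto simp: cover_def)
  qed
  show ?thesis
    unfolding weight_def using W p above_nonempty[OF p] finite_K
    by (intro continuous_on_diff continuous_on_Max_image) auto
qed

theorem strong_deformation_retract:
  "strong_deformation_retract_of (\<Union>C\<in>chains. convex hull (chi ` C)) X"
proof -
  have "\<forall>f\<in>K. \<exists>u :: 'v \<Rightarrow> real. continuous_on UNIV u \<and> (\<forall>x. u x \<le> 1) \<and>
      (\<forall>a\<in>bary. u (pt a) = tail a f) \<and> (\<forall>x\<in>X. u x = 1 \<longleftrightarrow> x \<in> D f)"
    using tail_extension by metis
  then obtain u :: "'i \<Rightarrow> 'v \<Rightarrow> real" where "\<forall>f\<in>K. continuous_on UNIV (u f) \<and>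
      (\<forall>x. u f x \<le> 1) \<and> (\<forall>a\<in>bary. u f (pt a) = tail a f) \<and> (\<forall>x\<in>X. u f x = 1 \<longleftrightarrow> x \<in> D f)"
    unfolding bchoice_iff by blast
  then have u: "\<And>f. f \<in> K \<Longrightarrow> continuous_on UNIV (u f)"
      "\<And>f x. f \<in> K \<Longrightarrow> u f x \<le> 1" "\<And>f a. f \<in> K \<Longrightarrow> a \<in> bary \<Longrightarrow> u f (pt a) = tail a f"
      "\<And>f x. f \<in> K \<Longrightarrow> x \<in> X \<Longrightarrow> u f x = 1 \<longleftrightarrow> x \<in> D f"
    by blast+
  define c where "c x p = weight (\<lambda>f. u f x) p" for x p
  define s where "s x = sum (c x) P" for x
  \<comment> \<open>The value \<open>0\<close> outside \<open>P\<close> ensures the nonnegativity at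
    every index that \<open>bary\<close> demands.\<close>
  define b where "b x p = (if p \<in> P then c x p / s x else 0)" for x p
  define r where "r x = pt (b x)" for x
  have Y: "(\<Union>C\<in>chains. convex hull (chi ` C)) = pt ` bary"
    unfolding Union_hull_chains pt_def ..
  have c0: "0 \<le> c x p" if "p \<in> P" for x p
    unfolding c_def by (rule weight_nonneg[OF that])
  have s0: "0 < s x" if x: "x \<in> X" for x
  proof -
    obtain k where k: "k \<in> P" "x \<in> D k" using x by (auto simp: X_def)
    have "W (\<lambda>f. u f x) T < 1" by (rule W_T_less_1) (use u x in auto)
    then obtain p where p: "p \<in> P" "0 < c x p"
      using ex_weight_pos[of "\<lambda>f. u f x" k] u k x unfolding c_def by auto
    then show ?thesis
      unfolding s_def using c0 finite_P by (metis sum_pos2)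
  qed
  have pos: "0 < b x p \<longleftrightarrow> p \<in> P \<and> 0 < c x p" if "x \<in> X" for x p
    using s0[OF that] by (auto simp: b_def zero_less_divide_iff)
  have b: "b x \<in> bary" if x: "x \<in> X" for x
    unfolding bary_def
  proof (intro CollectI conjI ballI impI allI)
    show "0 \<le> b x g" for g using c0[of g x] s0[OF x] by (simp add: b_def)
    have "sum (b x) P = (\<Sum>p\<in>P. c x p / s x)" by (simp add: b_def)
    then show "sum (b x) P = 1" using s0[OF x] by (simp add: s_def flip: sum_divide_distrib)
    fix g h assume "g \<in> P" "h \<in> P" "0 < b x g" "0 < b x h"
    then have "0 < weight (\<lambda>f. u f x) g" "0 < weight (\<lambda>f. u f x) h" "g \<in> K" "h \<in> K"
      using pos[OF x] by (simp_all add: c_def)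
    \<comment> \<open>One of the two \<open>W\<close>-values is at most the other, and
      \<open>weight_pos_le\<close> turns this into comparability.\<close>
    then show "g \<le> h \<or> h \<le> g"
      using weight_pos_le[OF \<open>g \<in> P\<close>] weight_pos_le[OF \<open>h \<in> P\<close>] linear by metis
  qed
  have rD: "r x \<in> D k" if "x \<in> D k" "k \<in> P" for x k
    unfolding r_def
  proof (rule pt_in_D)
    have x: "x \<in> X" using that by (auto simp: X_def)
    show "b x \<in> bary" by (rule b[OF x])
    show "k \<in> K" using that by simp
    show "k \<le> g" if "g \<in> P" "0 < b x g" for g
      using weight_support[of g "\<lambda>f. u f x" k] that u x \<open>x \<in> D k\<close> \<open>k \<in> P\<close> pos[OF x]
      by (auto simp: c_def)
  qed
  \<comment> \<open>On the polyhedron the weights are the coefficients themselves and already sum to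
    \<open>1\<close>.\<close>
  have r_id: "r (pt a) = pt a" if a: "a \<in> bary" for a
  proof -
    have "c (pt a) p = a p" if "p \<in> P" for p
      unfolding c_def by (rule weight_tail[OF a _ that]) (use u a in auto)
    moreover from this have "s (pt a) = 1" using a by (simp add: s_def bary_def)
    ultimately have "b (pt a) p = a p" if "p \<in> P" for p using that by (simp add: b_def)
    then show ?thesis by (simp add: r_def pt_def)
  qed
  have contc: "continuous_on X (\<lambda>x. c x p)" if "p \<in> P" for p
    unfolding c_def
    by (rule continuous_on_weight[OF _ that]) (use u continuous_on_subset in blast)
  have contr: "continuous_on X r"
  proof -
    have "r = (\<lambda>x. \<Sum>p\<in>P. (c x p / s x) *\<^sub>R chi p)"
      by (rule ext) (simp add: r_def pt_def b_def)
    then show ?thesis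
      using s0 contc unfolding s_def by (force intro!: continuous_intros)
  qed
  define H where "H = (\<lambda>(t, x). (1 - t) *\<^sub>R x + t *\<^sub>R r x)"
  show ?thesis
    unfolding strong_deformation_retract_of_def Y
  proof (intro conjI exI[of _ H] ballI)
    show "pt ` bary \<subseteq> X" using pt_in_X by blast
    show "continuous_on ({0..1} \<times> X) H"
      unfolding H_def case_prod_unfold
      by (intro continuous_intros continuous_on_compose2[OF contr]) auto
    show "H ` ({0..1} \<times> X) \<subseteq> X"
    proof clarify
      fix t :: real and x assume t: "t \<in> {0..1}" and "x \<in> X"
      then obtain k where k: "k \<in> P" "x \<in> D k" by (auto simp: X_def)
      then have "H (t, x) \<in> D k"
        unfolding H_def using rD[OF k(2,1)] D_convex[of k] t
        by (auto intro: convexD)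
      then show "H (t, x) \<in> X" using k by (auto simp: X_def)
    qed
    show "H (0, x) = x" for x by (simp add: H_def)
    show "H (1, x) \<in> pt ` bary" if "x \<in> X" for x using b[OF that] by (simp add: H_def r_def)
    show "H (t, y) = y" if "y \<in> pt ` bary" for t y
      using that r_id by (auto simp: H_def simp flip: scaleR_add_left)
  qed
qed

end

section \<open>Operators commuting with a subalgebra\<close>

text \<open>The minimum of the quadratic form on the unit sphere is an eigenvalue. Unlike the
  spectral condition, the condition on the form is visibly convex and closed in
  \<open>A\<close>.\<close>

lemma symmetric_op_nonneg_iff:
  fixes A :: "'a::euclidean_space \<Rightarrow>\<^sub>L 'a"
  assumes sym: "symmetric_op A"
  shows "(\<forall>c\<in>op_spectrum A. 0 \<le> c) \<longleftrightarrow> (\<forall>x. 0 \<le> A x \<bullet> x)"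
proof
  assume pos: "\<forall>x. 0 \<le> A x \<bullet> x"
  show "\<forall>c\<in>op_spectrum A. 0 \<le> c"
  proof
    fix c assume "c \<in> op_spectrum A"
    then obtain x where x: "x \<noteq> 0" "A x = c *\<^sub>R x" by (auto simp: op_spectrum_def)
    have "0 \<le> c * (x \<bullet> x)" using pos[rule_format, of x] x by simp
    moreover have "0 < x \<bullet> x" using x by simp
    ultimately show "0 \<le> c" by (simp only: zero_le_mult_iff) linarith
  qed
next
  assume spec: "\<forall>c\<in>op_spectrum A. 0 \<le> c"
  have "continuous_on (sphere 0 1) (\<lambda>x. A x \<bullet> x)"
    by (intro continuous_intros)
  moreover have "sphere (0::'a) 1 \<noteq> {}" by simp
  ultimately obtain e where e: "e \<in> sphere 0 1" "\<And>y. y \<in> sphere 0 1 \<Longrightarrow> A e \<bullet> e \<le> A y \<bullet> y"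
    using continuous_attains_inf[OF compact_sphere, of "0::'a" 1 "\<lambda>x. A x \<bullet> x"] by auto
  define c where "c = A e \<bullet> e"
  define B where "B y = A y - c *\<^sub>R y" for y
  have ee: "e \<bullet> e = 1" using e(1) by (simp add: norm_eq_1)
  have c_le: "c * (y \<bullet> y) \<le> A y \<bullet> y" for y
  proof (cases "y = 0")
    case False
    let ?z = "(1 / norm y) *\<^sub>R y"
    have "c \<le> A ?z \<bullet> ?z" unfolding c_def using False by (intro e(2)) simp
    also have "\<dots> = (A y \<bullet> y) / (y \<bullet> y)"
      by (simp add: blinfun.scaleR_right power2_norm_eq_inner[symmetric] power2_eq_square)
    finally show ?thesis using False by (simp add: field_simps)
  qed simp
  \<comment> \<open>The minimiser \<open>e\<close> of the Rayleigh quotient is an eigenvector, since the quadratic form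
    of \<open>B = A - c\<close> is nonnegative and vanishes at \<open>e\<close>.\<close>
  have "B e \<bullet> y = 0" for y
  proof (rule ccontr)
    assume ne: "B e \<bullet> y \<noteq> 0"
    have "0 \<le> 2 * t * (B e \<bullet> y) + t\<^sup>2 * (B y \<bullet> y)" for t
    proof -
      have "A y \<bullet> e = A e \<bullet> y" using sym by (metis symmetric_op_def inner_commute)
      then have "A (e + t *\<^sub>R y) \<bullet> (e + t *\<^sub>R y) - c * ((e + t *\<^sub>R y) \<bullet> (e + t *\<^sub>R y))
          = 2 * t * (B e \<bullet> y) + t\<^sup>2 * (B y \<bullet> y)"
        unfolding B_def by (simp add: blinfun.add_right blinfun.scaleR_right inner_add_left
            inner_add_right inner_diff_left c_def ee inner_commute[of y e] algebra_simps power2_eq_square)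
      then show ?thesis using c_le[of "e + t *\<^sub>R y"] by linarith
    qed
    note ineq = this
    have By: "0 \<le> B y \<bullet> y" using c_le[of y] by (simp add: B_def inner_diff_left)
    \<comment> \<open>The inequality is tested at \<open>t = - p / q\<close>; the added
      \<open>1\<close> keeps \<open>q\<close> positive when the form of \<open>B\<close> vanishes at
      \<open>y\<close>.\<close>
    define q where "q = B y \<bullet> y + 1"
    have q: "0 < q" using By by (simp add: q_def)
    define p where "p = B e \<bullet> y"
    have "0 \<le> 2 * (- p / q) * p + (- p / q)\<^sup>2 * (B y \<bullet> y)" using ineq[of "- p / q"] by (simp add: p_def)
    also have "\<dots> \<le> 2 * (- p / q) * p + (- p / q)\<^sup>2 * q"
      by (intro add_left_mono mult_left_mono) (auto simp: q_def)
    also have "\<dots> = - (p\<^sup>2 / q)" using q by (simp add: field_simps power2_eq_square)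
    finally have "p\<^sup>2 / q \<le> 0" by simp
    then show False using q ne by (simp add: p_def divide_le_0_iff)
  qed
  then have "A e = c *\<^sub>R e" using inner_eq_zero_iff[of "B e"] by (simp add: B_def)
  moreover have "e \<noteq> 0" using ee by auto
  ultimately have "c \<in> op_spectrum A" unfolding op_spectrum_def by blast
  then have "0 \<le> c" using spec by blast
  then show "\<forall>x. 0 \<le> A x \<bullet> x" using c_le by (meson inner_ge_zero mult_nonneg_nonneg order_trans)
qed

lemma Dset_eq:
  fixes br :: "'a::euclidean_space \<Rightarrow> 'a \<Rightarrow> 'a"
  shows "Dset br G k = {A. op_trace A = 1 \<and> (\<forall>x y. A x \<bullet> y = x \<bullet> A y) \<and> (\<forall>x. 0 \<le> A x \<bullet> x) \<and>
      (\<forall>f\<in>G. \<forall>x. A (f x) = f (A x)) \<and> (\<forall>x\<in>k. A x = 0) \<and>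
      (\<forall>X\<in>k. \<forall>y. A (br X y) = br X (A y))}"
proof -
  have "A o\<^sub>L f = f o\<^sub>L A \<longleftrightarrow> (\<forall>x. A (f x) = f (A x))" for A f :: "'a \<Rightarrow>\<^sub>L 'a"
    by (metis blinfun_apply_blinfun_compose blinfun_eqI)
  then show ?thesis
    unfolding Dset_def using symmetric_op_nonneg_iff unfolding symmetric_op_def by blast
qed

section \<open>Convexity, compactness and intersections of the sets \<open>Dset\<close>\<close>

lemma convex_Dset:
  assumes "bilinear br"
  shows "convex (Dset br G k)"
proof (rule convexI)
  fix A B :: "'a \<Rightarrow>\<^sub>L 'a" and s t :: real
  assume A: "A \<in> Dset br G k" and B: "B \<in> Dset br G k" and st: "0 \<le> s" "0 \<le> t" "s + t = 1"
  have "op_trace (s *\<^sub>R A + t *\<^sub>R B) = s * op_trace A + t * op_trace B"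
    by (simp add: op_trace_def blinfun.add_left blinfun.scaleR_left inner_add_left
        sum.distrib sum_distrib_left)
  moreover have "0 \<le> s * (A x \<bullet> x) + t * (B x \<bullet> x)" for x
    using A B st by (intro add_nonneg_nonneg mult_nonneg_nonneg) (auto simp only: Dset_eq)
  ultimately show "s *\<^sub>R A + t *\<^sub>R B \<in> Dset br G k"
    using A B st assms unfolding Dset_eq mem_Collect_eq
    by (simp add: blinfun.add_left blinfun.scaleR_left inner_add_left inner_add_right
        blinfun.add_right blinfun.scaleR_right bilinear_radd bilinear_rmul)
qed

lemma closed_Dset:
  fixes br :: "'a::euclidean_space \<Rightarrow> 'a \<Rightarrow> 'a"
  assumes "bilinear br"
  shows "closed (Dset br G k)"
proof -
  have br: "continuous_on UNIV (\<lambda>A::'a \<Rightarrow>\<^sub>L 'a. br X (A y))" for X y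
  proof -
    have "continuous_on UNIV (br X)"
      using assms by (intro linear_continuous_on)
        (simp add: bilinear_def linear_conv_bounded_linear)
    then show ?thesis
      by (rule continuous_on_compose2) (auto intro!: continuous_intros)
  qed
  have eq: "Dset br G k = (\<Inter>x. \<Inter>y. {A. blinfun_apply A x \<bullet> y = x \<bullet> A y}) \<inter> (\<Inter>x. {A. 0 \<le> blinfun_apply A x \<bullet> x}) \<inter>
      {A. (\<Sum>b\<in>Basis. blinfun_apply A b \<bullet> b) = 1} \<inter> (\<Inter>f\<in>G. \<Inter>x. {A. blinfun_apply A (blinfun_apply f x) = blinfun_apply f (blinfun_apply A x)}) \<inter>
      (\<Inter>x\<in>k. {A. blinfun_apply A x = 0}) \<inter> (\<Inter>X\<in>k. \<Inter>y. {A. blinfun_apply A (br X y) = br X (blinfun_apply A y)})"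
    unfolding Dset_eq op_trace_def by auto
  show ?thesis
    unfolding eq
    by (intro closed_Int closed_INT ballI closed_Collect_eq closed_Collect_le continuous_intros br)
qed

text \<open>The diagonal entries are nonnegative with sum \<open>1\<close>. Nonnegativity of the
  form at \<open>b + c\<close> and \<open>b - c\<close> bounds an off-diagonal entry by the mean of
  two diagonal ones.\<close>

lemma bounded_Dset: "bounded (Dset br G (k :: 'a::euclidean_space set))"
proof -
  have "norm A \<le> real (DIM('a) * DIM('a))" if A: "A \<in> Dset br G k" for A
  proof -
    have sym: "A x \<bullet> y = x \<bullet> A y" and pos: "0 \<le> A x \<bullet> x" for x y
      using A by (auto simp: Dset_eq)
    have tr: "(\<Sum>b\<in>Basis. A b \<bullet> b) = 1" using A by (auto simp: Dset_eq op_trace_def)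
    have diag: "A b \<bullet> b \<le> 1" if "b \<in> Basis" for b
      using member_le_sum[OF that, of "\<lambda>b. A b \<bullet> b"] pos tr by auto
    have entry: "\<bar>A b \<bullet> c\<bar> \<le> 1" if "b \<in> Basis" "c \<in> Basis" for b c
    proof -
      have cb: "A c \<bullet> b = A b \<bullet> c" using sym by (metis inner_commute)
      have "0 \<le> A (b + c) \<bullet> (b + c)" "0 \<le> A (b - c) \<bullet> (b - c)" by (rule pos)+
      then have "- 2 * (A b \<bullet> c) \<le> A b \<bullet> b + A c \<bullet> c" "2 * (A b \<bullet> c) \<le> A b \<bullet> b + A c \<bullet> c"
        by (simp_all add: blinfun.add_right blinfun.diff_right inner_add_left inner_add_right
            inner_diff_left inner_diff_right cb)
      then show ?thesis using diag that by (smt (verit))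
    qed
    have col: "norm (A b) \<le> DIM('a)" if "b \<in> Basis" for b
    proof -
      have "norm (A b) \<le> (\<Sum>c\<in>Basis. \<bar>A b \<bullet> c\<bar>)" by (rule norm_le_l1)
      also have "\<dots> \<le> (\<Sum>c\<in>(Basis::'a set). 1)" using entry[OF that] by (intro sum_mono) auto
      finally show ?thesis by simp
    qed
    show ?thesis
    proof (rule norm_blinfun_bound)
      fix x
      have "A x = (\<Sum>b\<in>Basis. (x \<bullet> b) *\<^sub>R A b)"
        by (subst euclidean_representation[of x, symmetric])
          (simp only: blinfun.sum_right blinfun.scaleR_right)
      also have "norm \<dots> \<le> (\<Sum>b\<in>(Basis::'a set). norm x * real DIM('a))"
        using col Basis_le_norm by (intro sum_norm_le) (auto intro!: mult_mono)
      finally show "norm (A x) \<le> real (DIM('a) * DIM('a)) * norm x" by (simp add: mult_ac)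
    qed simp
  qed
  then show ?thesis unfolding bounded_iff by blast
qed

lemma Dset_UNIV: "Dset br G UNIV = {}"
  by (auto simp: Dset_eq op_trace_def)

lemma Dset_antimono: "k \<subseteq> l \<Longrightarrow> Dset br G l \<subseteq> Dset br G k"
  by (auto simp: Dset_def)

lemma subalgebra_hull_subset: "subalgebra br k \<Longrightarrow> S \<subseteq> k \<Longrightarrow> subalgebra_hull br S \<subseteq> k"
  by (auto simp: subalgebra_hull_def)

lemma subset_subalgebra_hull: "S \<subseteq> subalgebra_hull br S"
  by (auto simp: subalgebra_hull_def)

text \<open>For fixed \<open>A\<close>, the elements that \<open>A\<close> annihilates and whose adjoint action commutes
  with \<open>A\<close> form a subalgebra.\<close>

lemma Dset_Int_subset:
  assumes lie: "lie_algebra br"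
  shows "Dset br G k \<inter> Dset br G l \<subseteq> Dset br G (subalgebra_hull br (k \<union> l))"
proof
  fix A assume A: "A \<in> Dset br G k \<inter> Dset br G l"
  have bil: "bilinear br" and jac: "br x (br y z) + br y (br z x) + br z (br x y) = 0"
    and alt: "br x x = 0" for x y z
    using lie by (auto simp: lie_algebra_def)
  note bils = bilinear_ladd[OF bil] bilinear_radd[OF bil] bilinear_lmul[OF bil]
    bilinear_rmul[OF bil] bilinear_lzero[OF bil] bilinear_rzero[OF bil] bilinear_rneg[OF bil]
  have anti: "br y x = - br x y" for x y
    using alt[of "x + y"] alt[of x] alt[of y] by (simp add: bils add_eq_0_iff)
  \<comment> \<open>The adjoint action of a bracket is a commutator of adjoint actions, so it
    commutes with \<open>A\<close> if both of them do.\<close>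
  have br_br: "br (br x y) z = br x (br y z) - br y (br x z)" for x y z
    using jac[of x y z] anti[of z "br x y"] anti[of z x]
    by (simp add: bils)
  define N where "N = {X. A X = 0 \<and> (\<forall>y. A (br X y) = br X (A y))}"
  have "subalgebra br N"
    unfolding subalgebra_def subspace_def N_def
    by (auto simp: bils br_br blinfun.add_right blinfun.scaleR_right blinfun.diff_right)
  moreover have "k \<union> l \<subseteq> N" using A by (auto simp: N_def Dset_def)
  ultimately have "subalgebra_hull br (k \<union> l) \<subseteq> N" by (rule subalgebra_hull_subset)
  then show "A \<in> Dset br G (subalgebra_hull br (k \<union> l))"
    using A by (auto simp: N_def Dset_def)
qed

section \<open>Orthogonal projections and the operators \<open>chibar\<close>\<close>

lemma orth_proj_unique:
  assumes "subspace k" "y \<in> k" "\<And>z. z \<in> k \<Longrightarrow> (x - y) \<bullet> z = 0"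
  shows "orth_proj k x = y"
  unfolding orth_proj_def
proof (rule the_equality)
  show "y \<in> k \<and> (\<forall>z\<in>k. (x - y) \<bullet> z = 0)" using assms by blast
  fix w assume w: "w \<in> k \<and> (\<forall>z\<in>k. (x - w) \<bullet> z = 0)"
  have "y - w \<in> k" using assms w by (simp add: subspace_diff)
  then have "(x - w) \<bullet> (y - w) = 0" "(x - y) \<bullet> (y - w) = 0" using assms w by auto
  then have "(y - w) \<bullet> (y - w) = 0" by (simp add: inner_diff_left inner_diff_right)
  then show "w = y" by simp
qed

lemma orth_proj_basis:
  fixes k :: "'a::euclidean_space set"
  assumes "subspace k"
  obtains E where "finite E" "E \<subseteq> k" "card E = dim k" "\<And>e. e \<in> E \<Longrightarrow> norm e = 1"
    "\<And>x. orth_proj k x = (\<Sum>e\<in>E. (x \<bullet> e) *\<^sub>R e)"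
    "\<And>x z. z \<in> k \<Longrightarrow> (x - orth_proj k x) \<bullet> z = 0"
proof -
  obtain E where E: "E \<subseteq> k" "pairwise orthogonal E" "\<And>x. x \<in> E \<Longrightarrow> norm x = 1"
      "independent E" "card E = dim k" "span E = k"
    using orthonormal_basis_subspace[OF assms] by metis
  have fin: "finite E" using E(4) independent_imp_finite by blast
  define p where "p x = (\<Sum>e\<in>E. (x \<bullet> e) *\<^sub>R e)" for x
  have orth: "(x - p x) \<bullet> z = 0" if "z \<in> k" for x z
  proof -
    have "(x - p x) \<bullet> e = 0" if e: "e \<in> E" for e
    proof -
      have "p x \<bullet> e = (\<Sum>d\<in>E. (x \<bullet> d) * (d \<bullet> e))" by (simp add: p_def inner_sum_left)
      also have "\<dots> = (\<Sum>d\<in>E. if d = e then x \<bullet> e else 0)"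
        using E(2,3) e by (intro sum.cong) (auto simp: pairwise_def orthogonal_def norm_eq_1)
      also have "\<dots> = x \<bullet> e" using fin e by simp
      finally show ?thesis by (simp add: inner_diff_left)
    qed
    then have "orthogonal (x - p x) z"
      using orthogonal_to_span[of z E "x - p x"] that E(6) by (auto simp: orthogonal_def)
    then show ?thesis by (simp add: orthogonal_def)
  qed
  have "p x \<in> k" for x
    unfolding p_def using E(1) assms by (intro subspace_sum subspace_scale) auto
  then have proj: "orth_proj k x = p x" for x using orth assms by (intro orth_proj_unique)
  show thesis
    using that[of E] fin E(1,3,5) orth proj unfolding p_def by metis
qed

context
  fixes k :: "'a::euclidean_space set"
  assumes k: "subspace k"
begin

lemma orth_proj_in: "orth_proj k x \<in> k"
  by (rule orth_proj_basis[OF k]) (use k in \<open>auto intro!: subspace_sum subspace_scale\<close>)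

lemma orth_proj_orth: "z \<in> k \<Longrightarrow> (x - orth_proj k x) \<bullet> z = 0"
  by (rule orth_proj_basis[OF k])

lemma chibar_apply:
  "chibar k x = (1 / real (DIM('a) - dim k)) *\<^sub>R (x - orth_proj k x)"
proof -
  obtain E where "\<And>x. orth_proj k x = (\<Sum>e\<in>E. (x \<bullet> e) *\<^sub>R e)"
    by (rule orth_proj_basis[OF k]) metis
  then have eq: "orth_proj k = (\<lambda>x. \<Sum>e\<in>E. (x \<bullet> e) *\<^sub>R e)" by (rule ext)
  have "bounded_linear (\<lambda>x. (1 / real (DIM('a) - dim k)) *\<^sub>R (x - orth_proj k x))"
    unfolding eq linear_conv_bounded_linear[symmetric]
    by (rule linearI) (simp_all add: inner_add_left scaleR_add_left sum.distrib scaleR_sum_right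
        scaleR_add_right scaleR_diff_right mult.left_commute mult.commute)
  then show ?thesis by (simp add: chibar_def bounded_linear_Blinfun_apply)
qed

text \<open>The right-hand side is symmetric in \<open>x\<close> and \<open>y\<close>, which yields
  the symmetry of \<open>chibar k\<close>.\<close>

lemma inner_orth_diff: "(x - orth_proj k x) \<bullet> y = (x - orth_proj k x) \<bullet> (y - orth_proj k y)"
  using orth_proj_orth[OF orth_proj_in] by (simp add: inner_diff_right)

lemma chibar_inner: "chibar k x \<bullet> x = (norm (x - orth_proj k x))\<^sup>2 / real (DIM('a) - dim k)"
  by (simp add: chibar_apply power2_norm_eq_inner inner_orth_diff[of x x])

lemma op_trace_chibar:
  assumes "k \<noteq> UNIV"
  shows "op_trace (chibar k) = 1"
proof -
  obtain E where E: "card E = dim k" "\<And>e. e \<in> E \<Longrightarrow> norm e = 1"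
      "\<And>x. orth_proj k x = (\<Sum>e\<in>E. (x \<bullet> e) *\<^sub>R e)"
    by (rule orth_proj_basis[OF k]) metis
  \<comment> \<open>Strictness makes the natural-number difference in \<open>chibar\<close> a
    nonzero divisor.\<close>
  have dim: "dim k < DIM('a)"
    using assms k dim_eq_full[of k] dim_subset_UNIV[of k] span_eq_iff[of k] by (metis le_neq_implies_less)
  have "(\<Sum>b\<in>Basis. orth_proj k b \<bullet> b) = (\<Sum>b\<in>Basis. \<Sum>e\<in>E. (e \<bullet> b) * (e \<bullet> b))"
    unfolding E(3) inner_sum_left by (simp add: inner_commute)
  also have "\<dots> = (\<Sum>e\<in>E. e \<bullet> e)"
    by (subst sum.swap) (simp add: euclidean_inner[symmetric])
  also have "\<dots> = dim k" using E(1,2) by (simp add: norm_eq_1)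
  finally have "(\<Sum>b\<in>Basis. (b - orth_proj k b) \<bullet> b) = real (DIM('a) - dim k)"
    using dim by (simp add: inner_diff_left sum_subtractf inner_Basis of_nat_diff)
  then show ?thesis
    using dim by (simp add: op_trace_def chibar_apply flip: sum_divide_distrib)
qed

end

text \<open>Members of \<open>G\<close> are isometries preserving \<open>k\<close>, as are their
  inverses, and \<open>br x\<close> with \<open>x\<close> in \<open>k\<close> is skew and preserves
  \<open>k\<close>. All of them preserve the orthogonal complement too, so they commute with the
  projection.\<close>

lemma chibar_in_Dset:
  fixes br :: "'a::euclidean_space \<Rightarrow> 'a \<Rightarrow> 'a"
  assumes lie: "lie_algebra br" and Q: "ad_invariant_inner br" and G: "compact_aut_group br h G"
    and sub: "subalgebra br k" and inv: "invariant_under G k" and ne: "k \<noteq> UNIV"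
  shows "chibar k \<in> Dset br G k"
proof -
  have k: "subspace k" and br_k: "\<And>x y. x \<in> k \<Longrightarrow> y \<in> k \<Longrightarrow> br x y \<in> k"
    using sub by (auto simp: subalgebra_def)
  have bil: "bilinear br" and alt: "br x x = 0" for x
    using lie by (auto simp: lie_algebra_def)
  have anti: "br y x = - br x y" for x y
    using alt[of "x + y"] alt[of x] alt[of y]
    by (simp add: bilinear_ladd[OF bil] bilinear_radd[OF bil] add_eq_0_iff)
  let ?P = "orth_proj k"
  have sym: "chibar k x \<bullet> y = x \<bullet> chibar k y" for x y
    using inner_orth_diff[OF k, of x y] inner_orth_diff[OF k, of y x]
    by (simp add: chibar_apply[OF k] inner_commute)
  have pos: "0 \<le> chibar k x \<bullet> x" for x
    by (simp add: chibar_inner[OF k])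
  have comm: "chibar k (f x) = f (chibar k x)" if f: "f \<in> G" for f x
  proof -
    obtain g where g: "g \<in> G" "f o\<^sub>L g = id_blinfun" using G f by (auto simp: compact_aut_group_def)
    have fg: "f (g z) = z" for z using g(2) by (metis blinfun_apply_blinfun_compose blinfun_apply_id_blinfun id_apply)
    have iso: "f x \<bullet> f y = x \<bullet> y" for x y using G f by (auto simp: compact_aut_group_def)
    have "?P (f x) = f (?P x)"
    proof (rule orth_proj_unique[OF k])
      show "f (?P x) \<in> k" using inv f orth_proj_in[OF k] by (auto simp: invariant_under_def)
      fix z assume z: "z \<in> k"
      then have "g z \<in> k" using inv g(1) by (auto simp: invariant_under_def)
      then have "(x - ?P x) \<bullet> g z = 0" by (rule orth_proj_orth[OF k])
      then have "f (x - ?P x) \<bullet> f (g z) = 0" by (simp only: iso)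
      then show "(f x - f (?P x)) \<bullet> z = 0" by (simp add: blinfun.diff_right fg)
    qed
    then show ?thesis by (simp add: chibar_apply[OF k] blinfun.scaleR_right blinfun.diff_right)
  qed
  have zero: "chibar k x = 0" if "x \<in> k" for x
    using orth_proj_unique[OF k that, of x] by (simp add: chibar_apply[OF k])
  have ad: "chibar k (br x y) = br x (chibar k y)" if x: "x \<in> k" for x y
  proof -
    have "?P (br x y) = br x (?P y)"
    proof (rule orth_proj_unique[OF k])
      show "br x (?P y) \<in> k" using x orth_proj_in[OF k] br_k by blast
      fix z assume z: "z \<in> k"
      have "(br x y - br x (?P y)) \<bullet> z = br x (y - ?P y) \<bullet> z"
        by (simp add: bilinear_rsub[OF bil])
      also have "\<dots> = - (br (y - ?P y) x \<bullet> z)" using anti[of x "y - ?P y"] by simp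
      also have "\<dots> = - ((y - ?P y) \<bullet> br x z)" using Q by (simp add: ad_invariant_inner_def)
      also have "\<dots> = 0" using orth_proj_orth[OF k br_k[OF x z]] by simp
      finally show "(br x y - br x (?P y)) \<bullet> z = 0" .
    qed
    then show ?thesis by (simp add: chibar_apply[OF k] bilinear_rmul[OF bil] bilinear_rsub[OF bil])
  qed
  show ?thesis
    unfolding Dset_eq using sym pos op_trace_chibar[OF k ne] comm zero ad by blast
qed

text \<open>The quadratic form of the combination at \<open>x\<close> is a sum of nonnegative
  multiples of squared distances from \<open>x\<close> to the \<open>g\<close>, so each term
  vanishes. This provides \<open>facet\<close>.\<close>

lemma chibar_combination_kernel:
  fixes a :: "'a::euclidean_space set \<Rightarrow> real"
  assumes "finite F" and F: "\<And>g. g \<in> F \<Longrightarrow> subspace g \<and> g \<noteq> UNIV" and a: "\<And>g. 0 \<le> a g"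
    and x: "(\<Sum>g\<in>F. a g *\<^sub>R chibar g) x = 0" and g: "g \<in> F" "0 < a g"
  shows "x \<in> g"
proof -
  have "(\<Sum>g\<in>F. a g *\<^sub>R chibar g) x \<bullet> x = (\<Sum>g\<in>F. a g * (chibar g x \<bullet> x))"
    by (simp add: blinfun.sum_left blinfun.scaleR_left inner_sum_left)
  then have "(\<Sum>g\<in>F. a g * (chibar g x \<bullet> x)) = 0" using x by simp
  moreover have "0 \<le> a g * (chibar g x \<bullet> x)" if "g \<in> F" for g
    using a F[OF that] by (simp add: chibar_inner)
  ultimately have "a g * (chibar g x \<bullet> x) = 0"
    using sum_nonneg_eq_0_iff[OF \<open>finite F\<close>, of "\<lambda>g. a g * (chibar g x \<bullet> x)"] g(1) by blast
  moreover have "dim g < DIM('a)"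
    using F[OF g(1)] dim_eq_full[of g] dim_subset_UNIV[of g] span_eq_iff[of g]
    by (metis le_neq_implies_less)
  ultimately have "x = orth_proj g x" using g F by (simp add: chibar_inner)
  then show ?thesis using orth_proj_in F g by metis
qed

section \<open>The operators on the Lie algebra as an instance of the abstract retraction\<close>

theorem theorem5p2:
  fixes br :: "'a::euclidean_space \<Rightarrow> 'a \<Rightarrow> 'a"
    and h :: "'a set"
    and G :: "('a \<Rightarrow>\<^sub>L 'a) set"
    and K :: "'a set set"
  assumes lie: "lie_algebra br"
    and Q: "ad_invariant_inner br"
    and h_sub: "subalgebra br h" and h_proper: "h \<noteq> UNIV"
    and G: "compact_aut_group br h G"
    and K_fin: "finite K"
    and K_mem: "\<And>k. k \<in> K \<Longrightarrow> subalgebra br k \<and> invariant_under G k \<and> h \<subset> k"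
    and K_top: "UNIV \<in> K"
    and K_join: "\<And>k l. k \<in> K \<Longrightarrow> l \<in> K \<Longrightarrow> subalgebra_hull br (k \<union> l) \<in> K"
  shows "compact (\<Union>k\<in>K - {UNIV}. Dset br G k) \<and>
         strong_deformation_retract_of (polyhedron (K - {UNIV})) (\<Union>k\<in>K - {UNIV}. Dset br G k)"
proof
  have bil: "bilinear br" using lie by (simp add: lie_algebra_def)
  have cpt: "compact (Dset br G k)" for k
    using closed_Dset[OF bil] bounded_Dset by (simp add: compact_eq_bounded_closed)
  show "compact (\<Union>k\<in>K - {UNIV}. Dset br G k)"
    using K_fin cpt by (intro compact_UN) auto
  interpret convex_join_system K UNIV "Dset br G" chibar
  proof
    fix k l assume k: "k \<in> K" and l: "l \<in> K"
    have "k \<union> l \<subseteq> subalgebra_hull br (k \<union> l)" by (rule subset_subalgebra_hull)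
    moreover have "\<forall>y\<in>K. k \<subseteq> y \<longrightarrow> l \<subseteq> y \<longrightarrow> subalgebra_hull br (k \<union> l) \<subseteq> y"
      using K_mem subalgebra_hull_subset by (metis Un_least)
    ultimately show "\<exists>z\<in>K. k \<subseteq> z \<and> l \<subseteq> z \<and> (\<forall>y\<in>K. k \<subseteq> y \<longrightarrow> l \<subseteq> y \<longrightarrow> z \<subseteq> y) \<and>
        Dset br G k \<inter> Dset br G l \<subseteq> Dset br G z"
      using Dset_Int_subset[OF lie, of G k l]
      by (intro bexI[OF _ K_join[OF k l]]) simp
  next
    fix a :: "'a set \<Rightarrow> real" and k g
    assume a: "\<And>g. 0 \<le> a g" and D: "(\<Sum>g\<in>K - {UNIV}. a g *\<^sub>R chibar g) \<in> Dset br G k"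
      and g: "g \<in> K - {UNIV}" "0 < a g"
    show "k \<subseteq> g"
    proof
      fix x assume "x \<in> k"
      then have "(\<Sum>g\<in>K - {UNIV}. a g *\<^sub>R chibar g) x = 0" using D by (simp add: Dset_def)
      then show "x \<in> g"
        using K_fin K_mem a g by (intro chibar_combination_kernel[of "K - {UNIV}"])
          (auto simp: subalgebra_def)
    qed
  qed (simp_all add: K_fin K_top cpt convex_Dset[OF bil] Dset_UNIV Dset_antimono K_mem
      chibar_in_Dset[OF lie Q G])
  have "polyhedron (K - {UNIV}) = (\<Union>C\<in>chains. convex hull (chibar ` C))"
    unfolding polyhedron_def chains_def image_Collect ..
  then show "strong_deformation_retract_of (polyhedron (K - {UNIV})) (\<Union>k\<in>K - {UNIV}. Dset br G k)"
    using strong_deformation_retract by (simp add: X_def)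
qed

end
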